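(* Each row sequence of the Bell polynomials triangle, of the Eulerian polynomials triangle, and of the Narayana polynomials triangle is strongly $q$-log-concave. That is, for every $n\ge 0$, the sequences $(B_{n,k}(q))_{0\le k\le n}$, $(E_{n,k}(q))_{0\le k\le n}$ and $(N_{n,k}(q))_{0\le k\le n}$ are strongly $q$-log-concave.
   Context: Each of the three triangles is an infinite lower triangular array of polynomials in $q$ with $(0,0)$ entry equal to $1$, $(0,k)$ entry equal to $0$ for $k>0$, and entries with column index $-1$ taken to be $0$, defined by the following recurrences for $n\ge 0$. Bell polynomials triangle: $B_{n+1,k}=B_{n,k-1}+(q+k)\,B_{n,k}+q(1+k)\,B_{n,k+1}$ for $k\ge 0$. Eulerian polynomials triangle: $E_{n+1,k}=E_{n,k-1}+(kq+k+1)\,E_{n,k}+(k+1)^2q\,E_{n,k+1}$ for $k\ge 0$. Narayana polynomials triangle: $N_{n+1,0}=q N_{n,0}+ q N_{n,1}$ and $N_{n+1,k}=N_{n,k-1}+(q+1)\,N_{n,k}+q\,N_{n,k+1}$ for $k\ge 1$. For polynomials $f,g$ in $q$ with real coefficients, $f(q)\geq_q g(q)$ means that $f(q)-g(q)$ has only nonnegative coefficients. A finite sequence $(p_k(q))_{0\le k\le n}$ of polynomials with nonnegative coefficients is strongly $q$-log-concave if $p_k(q)p_l(q)\geq_q p_{k-1}(q)p_{l+1}(q)$ for all $1\le k\le l\le n-1$. *)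

theory Defs
  imports "HOL-Computational_Algebra.Polynomial"
begin

abbreviation qvar :: "real poly" where
  "qvar \<equiv> [:0, 1:]"

(* Column indices are natural numbers; the case k = 0 is separated because the
   entries in column -1 are 0 and k - 1 would truncate. *)

fun Bell_triangle :: "nat \<Rightarrow> nat \<Rightarrow> real poly" where
  "Bell_triangle 0 k = (if k = 0 then 1 else 0)"
| "Bell_triangle (Suc n) k =
     (if k = 0 then 0 else Bell_triangle n (k - 1))
     + (qvar + of_nat k) * Bell_triangle n k
     + qvar * (1 + of_nat k) * Bell_triangle n (k + 1)"

fun Eulerian_triangle :: "nat \<Rightarrow> nat \<Rightarrow> real poly" where
  "Eulerian_triangle 0 k = (if k = 0 then 1 else 0)"
| "Eulerian_triangle (Suc n) k =
     (if k = 0 then 0 else Eulerian_triangle n (k - 1))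
     + (of_nat k * qvar + of_nat k + 1) * Eulerian_triangle n k
     + (of_nat k + 1)^2 * qvar * Eulerian_triangle n (k + 1)"

fun Narayana_triangle :: "nat \<Rightarrow> nat \<Rightarrow> real poly" where
  "Narayana_triangle 0 k = (if k = 0 then 1 else 0)"
| "Narayana_triangle (Suc n) k =
     (if k = 0 then qvar * Narayana_triangle n 0 + qvar * Narayana_triangle n 1
      else Narayana_triangle n (k - 1) + (qvar + 1) * Narayana_triangle n k
           + qvar * Narayana_triangle n (k + 1))"

(* This is the coefficientwise partial order, not the library's linear order on
   polynomials, which looks only at the leading coefficient of the difference. *)

definition q_ge :: "real poly \<Rightarrow> real poly \<Rightarrow> bool" (infix "\<ge>\<^sub>q" 50) where
  "f \<ge>\<^sub>q g \<longleftrightarrow> (\<forall>i. coeff (f - g) i \<ge> 0)"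

(* The finite sequence (p k) for 0 <= k <= n; values p k with k > n are irrelevant.
   The bound l < n is l <= n - 1 without truncated subtraction. *)

definition strongly_q_log_concave :: "nat \<Rightarrow> (nat \<Rightarrow> real poly) \<Rightarrow> bool" where
  "strongly_q_log_concave n p \<longleftrightarrow>
     (\<forall>k\<le>n. \<forall>i. coeff (p k) i \<ge> 0) \<and>
     (\<forall>k l. 1 \<le> k \<and> k \<le> l \<and> l < n \<longrightarrow> p k * p l \<ge>\<^sub>q p (k - 1) * p (l + 1))"

end

theory Submission
  imports Defs
begin

text \<open>
  All three triangles satisfy \<open>T\<^sub>n\<^sub>+\<^sub>1\<^sub>,\<^sub>k = T\<^sub>n\<^sub>,\<^sub>k\<^sub>-\<^sub>1 + g\<^sub>k T\<^sub>n\<^sub>,\<^sub>k + h\<^sub>k T\<^sub>n\<^sub>,\<^sub>k\<^sub>+\<^sub>1\<close>.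
  Strong log-concavity of a row says that, for a fixed index sum, the products of two entries
  decrease as the indices move apart.  Expand a minor of row \<open>n + 1\<close> into products of entries
  of row \<open>n\<close> and group them by index sum: after summation by parts, each group is a
  combination of minors of row \<open>n\<close> whose coefficients are partial sums of polynomials in the
  weights \<open>g\<close> and \<open>h\<close>.  A few inequalities between the weights make all these sums nonnegative.
\<close>

definition qnonneg :: "real poly \<Rightarrow> bool" where
  "qnonneg f \<longleftrightarrow> (\<forall>i. coeff f i \<ge> 0)"

lemma q_ge_iff_qnonneg: "f \<ge>\<^sub>q g \<longleftrightarrow> qnonneg (f - g)"
  by (simp add: q_ge_def qnonneg_def)

lemma qnonneg_0 [simp]: "qnonneg 0"
  by (simp add: qnonneg_def)

lemma qnonneg_1 [simp]: "qnonneg 1"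
  by (simp add: qnonneg_def)

lemma qnonneg_of_nat [simp]: "qnonneg (of_nat m)"
  by (simp add: qnonneg_def of_nat_poly coeff_pCons split: nat.split)

lemma qnonneg_numeral [simp]: "qnonneg (numeral m)"
  by (metis of_nat_numeral qnonneg_of_nat)

lemma qnonneg_qvar [simp]: "qnonneg qvar"
  by (simp add: qnonneg_def coeff_pCons split: nat.split)

lemma qnonneg_add [simp]: "qnonneg f \<Longrightarrow> qnonneg g \<Longrightarrow> qnonneg (f + g)"
  by (simp add: qnonneg_def)

lemma qnonneg_mult [simp]: "qnonneg f \<Longrightarrow> qnonneg g \<Longrightarrow> qnonneg (f * g)"
  by (auto simp: qnonneg_def coeff_mult intro!: sum_nonneg)

lemma qnonneg_power [simp]: "qnonneg f \<Longrightarrow> qnonneg (f ^ m)"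
  by (induction m) simp_all

text \<open>Summation by parts: along a decreasing nonnegative chain only the partial sums of the
  coefficients must be nonnegative, so single coefficients may be negative.\<close>

lemma qnonneg_by_parts3:
  assumes "qnonneg (a - b)" "qnonneg (b - c)" "qnonneg c"
    and "qnonneg s" "qnonneg (s + t)" "qnonneg (s + t + r)"
  shows "qnonneg (s * a + t * b + r * c)"
proof -
  have "s * a + t * b + r * c = s * (a - b) + (s + t) * (b - c) + (s + t + r) * c"
    by (simp add: algebra_simps)
  then show ?thesis
    using assms by simp
qed

lemma qnonneg_by_parts4:
  assumes "qnonneg (a - b)" "qnonneg (b - c)" "qnonneg (c - d)" "qnonneg d"
    and "qnonneg s" "qnonneg (s + t)" "qnonneg (s + t + r)" "qnonneg (s + t + r + w)"
  shows "qnonneg (s * a + t * b + r * c + w * d)"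
proof -
  have "s * a + t * b + r * c + w * d
      = s * (a - b) + (s + t) * (b - c) + (s + t + r) * (c - d) + (s + t + r + w) * d"
    by (simp add: algebra_simps)
  then show ?thesis
    using assms by simp
qed

text \<open>The case \<open>i = j\<close> of this condition is vacuous; allowing it makes the chains of
  inequalities below uniform.\<close>

definition strong_lc :: "(nat \<Rightarrow> real poly) \<Rightarrow> bool" where
  "strong_lc u \<longleftrightarrow> (\<forall>k. qnonneg (u k)) \<and>
     (\<forall>i j. i \<le> j \<longrightarrow> qnonneg (u (Suc i) * u j - u i * u (Suc j)))"

lemma strong_lcD:
  assumes "strong_lc u"
  shows "qnonneg (u k)" "i \<le> j \<Longrightarrow> qnonneg (u (Suc i) * u j - u i * u (Suc j))"
  using assms by (auto simp: strong_lc_def)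

text \<open>In the expanded minor, \<open>g_sums\<close>, \<open>h_sums\<close>,
  \<open>gh_minors\<close> and \<open>h_minors\<close> are the total coefficients of the groups with
  index sums \<open>i + l + 2\<close> to \<open>i + l + 5\<close>. \<open>gg_h\<close> is the second
  coefficient of the group \<open>i + l + 3\<close>.\<close>

locale log_concave_weights =
  fixes g h :: "nat \<Rightarrow> real poly"
  assumes g_nonneg: "qnonneg (g k)" and h_nonneg: "qnonneg (h k)"
    and g_sums: "i < l \<Longrightarrow> qnonneg (g (Suc i) + g l - g i - g (Suc l))"
    and gg_h: "i < l \<Longrightarrow> qnonneg (g (Suc i) * g l - h i)"
    and h_sums: "i < l \<Longrightarrow> qnonneg (h (Suc i) + h l - h i - h (Suc l)
                    + g (Suc i) * g l - g i * g (Suc l))"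
    and gh_minors: "i < l \<Longrightarrow> qnonneg (h (Suc i) * g l + g (Suc i) * h l
                    - h i * g (Suc l) - g i * h (Suc l))"
    and h_minors: "i < l \<Longrightarrow> qnonneg (h (Suc i) * h l - h i * h (Suc l))"
begin

lemma step_minor:
  assumes lc: "strong_lc u" and il: "i < l"
  defines "w \<equiv> \<lambda>k. u k + g k * u (k + 1) + h k * u (k + 2)"
  shows "qnonneg (w (Suc i) * w l - w i * w (Suc l))"
proof -
  note [simp] = g_nonneg h_nonneg strong_lcD(1)[OF lc]
  have D: "qnonneg (u a * u b - u a' * u b')"
    if "a = Suc a'" "b' = Suc b" "a' \<le> b" for a b a' b'
    using strong_lcD(2)[OF lc that(3)] that by simp
  have D_mid: "qnonneg (u (i + 1) * u (l + 1) - u i * u (l + 2))"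
    "qnonneg (u (i + 2) * u (l + 1) - u (i + 1) * u (l + 2))"
    "qnonneg (u (i + 1) * u (l + 2) - u i * u (l + 3))"
    by (rule D; use il in simp)+
  \<comment> \<open>\<open>s1\<close> to \<open>s5\<close> treat the products with index sums
    \<open>i + l + 1\<close> to \<open>i + l + 5\<close> in turn.\<close>
  have s1: "qnonneg (u (i + 1) * u l - u i * u (l + 1))"
    by (rule D) (use il in auto)
  have s2: "qnonneg (g (Suc i) * (u (i + 2) * u l) + (g l - g i) * (u (i + 1) * u (l + 1))
      + (- g (Suc l)) * (u i * u (l + 2)))"
  proof (rule qnonneg_by_parts3)
    show "qnonneg (u (i + 2) * u l - u (i + 1) * u (l + 1))"
      by (rule D) (use il in auto)
    show "qnonneg (g (Suc i) + (g l - g i))"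
      using qnonneg_add[OF g_sums[OF il] g_nonneg[of "Suc l"]] by (simp add: algebra_simps)
    show "qnonneg (g (Suc i) + (g l - g i) + - g (Suc l))"
      using g_sums[OF il] by (simp add: algebra_simps)
  qed (use D_mid in auto)
  \<comment> \<open>The third partial sum exceeds the last by the nonnegative
    \<open>h (Suc l)\<close>. The same device gives the second partial sums in \<open>s2\<close> and
    \<open>s4\<close>.\<close>
  have last: "qnonneg (h (Suc i) + (g (Suc i) * g l - h i) + (h l - g i * g (Suc l)) + - h (Suc l))"
    using h_sums[OF il] by (simp add: algebra_simps)
  have third: "qnonneg (h (Suc i) + (g (Suc i) * g l - h i) + (h l - g i * g (Suc l)))"
    using qnonneg_add[OF last h_nonneg[of "Suc l"]] by (simp add: algebra_simps)
  have s3: "qnonneg (h (Suc i) * (u (i + 3) * u l) + (g (Suc i) * g l - h i) * (u (i + 2) * u (l + 1))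
      + (h l - g i * g (Suc l)) * (u (i + 1) * u (l + 2)) + (- h (Suc l)) * (u i * u (l + 3)))"
  proof (cases "l = Suc i")
    case False
    show ?thesis
    proof (rule qnonneg_by_parts4)
      \<comment> \<open>This comparison needs \<open>i + 2 \<le> l\<close>, hence the case
        split.\<close>
      show "qnonneg (u (i + 3) * u l - u (i + 2) * u (l + 1))"
        by (rule D) (use il False in auto)
    qed (use D_mid gg_h[OF il] third last in auto)
  next
    \<comment> \<open>Here the outer product \<open>u (i + 3) * u l\<close> coincides with the third one and is
      no longer the largest.\<close>
    case True
    have "qnonneg ((g (Suc i) * g l - h i) * (u (i + 2) * u (l + 1))
      + (h (Suc i) + h l - g i * g (Suc l)) * (u (i + 1) * u (l + 2))
      + (- h (Suc l)) * (u i * u (l + 3)))"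
    proof (rule qnonneg_by_parts3)
      show "qnonneg (g (Suc i) * g l - h i + (h (Suc i) + h l - g i * g (Suc l)))"
        using third by (simp add: algebra_simps)
      show "qnonneg (g (Suc i) * g l - h i + (h (Suc i) + h l - g i * g (Suc l)) + - h (Suc l))"
        using last by (simp add: algebra_simps)
    qed (use D_mid gg_h[OF il] in auto)
    then show ?thesis
      using True by (simp add: algebra_simps eval_nat_numeral)
  qed
  have s4: "qnonneg (h (Suc i) * g l * (u (i + 3) * u (l + 1))
      + (g (Suc i) * h l - h i * g (Suc l)) * (u (i + 2) * u (l + 2))
      + (- (g i * h (Suc l))) * (u (i + 1) * u (l + 3)))"
  proof (rule qnonneg_by_parts3)
    show "qnonneg (u (i + 3) * u (l + 1) - u (i + 2) * u (l + 2))"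
      "qnonneg (u (i + 2) * u (l + 2) - u (i + 1) * u (l + 3))"
      by (rule D; use il in simp)+
    show "qnonneg (h (Suc i) * g l + (g (Suc i) * h l - h i * g (Suc l)))"
      using qnonneg_add[OF gh_minors[OF il] qnonneg_mult[OF g_nonneg[of i] h_nonneg[of "Suc l"]]]
      by (simp add: algebra_simps)
    show "qnonneg (h (Suc i) * g l + (g (Suc i) * h l - h i * g (Suc l)) + - (g i * h (Suc l)))"
      using gh_minors[OF il] by (simp add: algebra_simps)
  qed auto
  have s5: "qnonneg (h (Suc i) * h l * (u (i + 3) * u (l + 2) - u (i + 2) * u (l + 3))
      + (h (Suc i) * h l - h i * h (Suc l)) * (u (i + 2) * u (l + 3)))"
    by (intro qnonneg_add qnonneg_mult h_minors D) (use il in auto)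
  have shifts: "w (Suc i) = u (i + 1) + g (Suc i) * u (i + 2) + h (Suc i) * u (i + 3)"
    "w (Suc l) = u (l + 1) + g (Suc l) * u (l + 2) + h (Suc l) * u (l + 3)"
    by (simp_all add: w_def eval_nat_numeral)
  have unshifted: "w i = u i + g i * u (i + 1) + h i * u (i + 2)"
    "w l = u l + g l * u (l + 1) + h l * u (l + 2)"
    by (simp_all add: w_def)
  show ?thesis
    using qnonneg_add[OF s1 qnonneg_add[OF s2 qnonneg_add[OF s3 qnonneg_add[OF s4 s5]]]]
    unfolding shifts unshifted by (simp add: algebra_simps)
qed

text \<open>Rows are shifted by one column, so that column \<open>-1\<close> of the triangle is \<open>u 0 = 0\<close>.\<close>

lemma strong_lc_step:
  assumes lc: "strong_lc u" and v0: "v 0 = 0"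
    and v: "\<And>k. v (Suc k) = u k + g k * u (k + 1) + h k * u (k + 2)"
  shows "strong_lc v"
proof -
  have nn: "qnonneg (v k)" for k
    by (cases k) (simp_all add: v0 v g_nonneg h_nonneg strong_lcD(1)[OF lc])
  moreover have "qnonneg (v (Suc i) * v j - v i * v (Suc j))" if "i \<le> j" for i j
  proof (cases i)
    case 0
    then show ?thesis using nn v0 by simp
  next
    case (Suc i')
    with that obtain j' where j': "j = Suc j'" by (cases j) auto
    show ?thesis
    proof (cases "i = j")
      case True
      then show ?thesis by (simp add: mult.commute)
    next
      case False
      with Suc j' that have "i' < j'" by simp
      from step_minor[OF lc this] show ?thesis
        unfolding Suc j' v .
    qed
  qed
  ultimately show ?thesis
    by (simp add: strong_lc_def)
qed

lemma triangle_strongly_q_log_concave: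
  fixes T :: "nat \<Rightarrow> nat \<Rightarrow> real poly"
  assumes T0: "\<And>k. T 0 k = (if k = 0 then 1 else 0)"
    and T_Suc: "\<And>n k. T (Suc n) k =
      (if k = 0 then 0 else T n (k - 1)) + g k * T n k + h k * T n (k + 1)"
  shows "strongly_q_log_concave n (T n)"
proof -
  define u where "u n k = (if k = 0 then 0 else T n (k - 1))" for n k
  have lc: "strong_lc (u n)" for n
  proof (induction n)
    case 0
    show ?case by (auto simp: strong_lc_def u_def T0)
  next
    case (Suc n)
    then show ?case
      by (rule strong_lc_step) (simp_all add: u_def T_Suc)
  qed
  have "qnonneg (T n k)" for k
    using strong_lcD(1)[OF lc, of n "Suc k"] by (simp add: u_def)
  \<comment> \<open>Because of the column shift, this is the minor of \<open>u n\<close> at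
    \<open>k\<close> and \<open>Suc l\<close>.\<close>
  moreover have "qnonneg (T n k * T n l - T n (k - 1) * T n (l + 1))" if "1 \<le> k" "k \<le> l" for k l
    using strong_lcD(2)[OF lc, of k "Suc l" n] that by (simp add: u_def)
  ultimately show ?thesis
    by (simp add: strongly_q_log_concave_def q_ge_iff_qnonneg qnonneg_def[symmetric])
qed

end

text \<open>In the weights, the variable \<open>q\<close> is an arbitrary nonnegative \<open>x\<close>: this keeps the
  simplifier from multiplying out the coefficient list of \<open>qvar\<close>.\<close>

lemma less_imp_Suc_add_eq: "i < (l :: nat) \<Longrightarrow> \<exists>d. l = Suc i + d"
  using less_iff_Suc_add by auto

text \<open>Since \<open>g\<close> is affine in \<open>k\<close>, \<open>g_sums\<close> reduces to
  0. The expressions in \<open>h_sums\<close>, \<open>gh_minors\<close> and \<open>h_minors\<close>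
  are multiples of \<open>l - i\<close>, which appears as \<open>Suc d\<close>.\<close>

lemma Bell_weights:
  assumes [simp]: "qnonneg x"
  shows "log_concave_weights (\<lambda>k. x + of_nat k) (\<lambda>k. x * (1 + of_nat k))"
proof (unfold_locales, goal_cases)
  case (4 i l)
  have "(x + of_nat (Suc i)) * (x + of_nat l) - x * (1 + of_nat i)
      = x * x + x * of_nat l + of_nat (Suc i) * of_nat l"
    by (simp add: algebra_simps)
  then show ?case by simp
next
  case (5 i l)
  then obtain d where l: "l = Suc i + d" using less_imp_Suc_add_eq by blast
  have "x * (1 + of_nat (Suc i)) + x * (1 + of_nat l) - x * (1 + of_nat i) - x * (1 + of_nat (Suc l))
      + (x + of_nat (Suc i)) * (x + of_nat l) - (x + of_nat i) * (x + of_nat (Suc l))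
      = of_nat (Suc d)"
    unfolding l by (simp add: algebra_simps)
  then show ?case by (metis qnonneg_of_nat)
next
  case (6 i l)
  then obtain d where l: "l = Suc i + d" using less_imp_Suc_add_eq by blast
  have "x * (1 + of_nat (Suc i)) * (x + of_nat l) + (x + of_nat (Suc i)) * (x * (1 + of_nat l))
      - x * (1 + of_nat i) * (x + of_nat (Suc l)) - (x + of_nat i) * (x * (1 + of_nat (Suc l)))
      = 2 * x * of_nat (Suc d)"
    unfolding l by (simp add: algebra_simps)
  then show ?case by (metis qnonneg_of_nat qnonneg_mult qnonneg_numeral assms)
next
  case (7 i l)
  then obtain d where l: "l = Suc i + d" using less_imp_Suc_add_eq by blast
  have "x * (1 + of_nat (Suc i)) * (x * (1 + of_nat l)) - x * (1 + of_nat i) * (x * (1 + of_nat (Suc l)))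
      = x * x * of_nat (Suc d)"
    unfolding l by (simp add: algebra_simps)
  then show ?case by (metis qnonneg_of_nat qnonneg_mult assms)
qed simp_all

lemma Eulerian_weights:
  assumes [simp]: "qnonneg x"
  shows "log_concave_weights (\<lambda>k. of_nat k * x + of_nat k + 1) (\<lambda>k. (of_nat k + 1)^2 * x)"
proof (unfold_locales, goal_cases)
  case (3 i l)
  show ?case by (simp add: algebra_simps)
next
  case (4 i l)
  then obtain d where l: "l = Suc i + d" using less_imp_Suc_add_eq by blast
  \<comment> \<open>The square is absorbed by the cross terms:
    \<open>2 * Suc i * l - (Suc i)^2 = Suc i * (l + d)\<close>.\<close>
  have "(of_nat (Suc i) * x + of_nat (Suc i) + 1) * (of_nat l * x + of_nat l + 1)
      - (of_nat i + 1)\<^sup>2 * x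
      = of_nat (Suc i * l) * (x * x + 1) + of_nat (Suc i * (l + d)) * x
        + of_nat (Suc i + l) * (x + 1) + 1"
    unfolding l by (simp add: algebra_simps power2_eq_square)
  then show ?case by (metis qnonneg_of_nat qnonneg_mult qnonneg_add qnonneg_1 assms)
next
  case (5 i l)
  then obtain d where l: "l = Suc i + d" using less_imp_Suc_add_eq by blast
  \<comment> \<open>The products of \<open>g\<close> contribute \<open>Suc d * (x + 1)^2\<close> and
    the terms in \<open>h\<close> contribute \<open>- 2 * Suc d * x\<close>.\<close>
  have "(of_nat (Suc i) + 1)\<^sup>2 * x + (of_nat l + 1)\<^sup>2 * x - (of_nat i + 1)\<^sup>2 * x
      - (of_nat (Suc l) + 1)\<^sup>2 * x
      + (of_nat (Suc i) * x + of_nat (Suc i) + 1) * (of_nat l * x + of_nat l + 1)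
      - (of_nat i * x + of_nat i + 1) * (of_nat (Suc l) * x + of_nat (Suc l) + 1)
      = of_nat (Suc d) * (x * x + 1)"
    unfolding l by (simp add: algebra_simps power2_eq_square)
  then show ?case by (metis qnonneg_of_nat qnonneg_mult qnonneg_add qnonneg_1 assms)
next
  case (6 i l)
  then obtain d where l: "l = Suc i + d" using less_imp_Suc_add_eq by blast
  have "(of_nat (Suc i) + 1)\<^sup>2 * x * (of_nat l * x + of_nat l + 1)
      + (of_nat (Suc i) * x + of_nat (Suc i) + 1) * ((of_nat l + 1)\<^sup>2 * x)
      - (of_nat i + 1)\<^sup>2 * x * (of_nat (Suc l) * x + of_nat (Suc l) + 1)
      - (of_nat i * x + of_nat i + 1) * ((of_nat (Suc l) + 1)\<^sup>2 * x)
      = x * of_nat (Suc d) * (of_nat (2 * i + d + 6) * x + of_nat (2 * i + d + 4))"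
    unfolding l by (simp add: algebra_simps power2_eq_square)
  then show ?case by (metis qnonneg_of_nat qnonneg_mult qnonneg_add assms)
next
  case (7 i l)
  then obtain d where l: "l = Suc i + d" using less_imp_Suc_add_eq by blast
  \<comment> \<open>A difference of squares, with
    \<open>(i + 2) * (l + 1) - (i + 1) * (l + 2) = l - i\<close>.\<close>
  have "(of_nat (Suc i) + 1)\<^sup>2 * x * ((of_nat l + 1)\<^sup>2 * x)
      - (of_nat i + 1)\<^sup>2 * x * ((of_nat (Suc l) + 1)\<^sup>2 * x)
      = x * x * of_nat (Suc d) * of_nat ((i + 2) * (l + 1) + (i + 1) * (l + 2))"
    unfolding l by (simp add: algebra_simps power2_eq_square)
  then show ?case by (metis qnonneg_of_nat qnonneg_mult assms)
qed simp_all

text \<open>As \<open>h\<close> is constant, \<open>g_sums\<close>, \<open>h_sums\<close> and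
  \<open>gh_minors\<close> are \<open>g (Suc i) - g i\<close> times \<open>1\<close>,
  \<open>x + 1\<close> and \<open>x\<close>. This difference is 1 for \<open>i = 0\<close> and 0
  otherwise.\<close>

lemma Narayana_weights:
  assumes [simp]: "qnonneg x"
  shows "log_concave_weights (\<lambda>k. if k = 0 then x else x + 1) (\<lambda>_. x)"
proof (unfold_locales, goal_cases)
  case (4 i l)
  have "(x + 1) * (x + 1) - x = x * x + x + 1"
    by (simp add: algebra_simps)
  with 4 show ?case by simp
next
  case (5 i l)
  have "(x + 1) * (x + 1) - x * (x + 1) = x + 1"
    by (simp add: algebra_simps)
  with 5 show ?case by simp
next
  case (6 i l)
  have "x * (x + 1) + (x + 1) * x - x * (x + 1) - x * x = x"
    by (simp add: algebra_simps)
  with 6 show ?case by (simp add: mult.commute)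
qed auto

theorem corollary4p3:
  fixes n :: nat
  shows "strongly_q_log_concave n (Bell_triangle n)
       \<and> strongly_q_log_concave n (Eulerian_triangle n)
       \<and> strongly_q_log_concave n (Narayana_triangle n)"
proof (intro conjI)
  show "strongly_q_log_concave n (Bell_triangle n)"
    by (rule log_concave_weights.triangle_strongly_q_log_concave[OF Bell_weights[OF qnonneg_qvar]])
      (simp_all only: Bell_triangle.simps)
  show "strongly_q_log_concave n (Eulerian_triangle n)"
    by (rule log_concave_weights.triangle_strongly_q_log_concave[OF Eulerian_weights[OF qnonneg_qvar]])
      (simp_all only: Eulerian_triangle.simps)
  \<comment> \<open>The exceptional recurrence in column 0 is encoded by the weight
    \<open>g 0 = x\<close>.\<close>
  show "strongly_q_log_concave n (Narayana_triangle n)"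
    by (rule log_concave_weights.triangle_strongly_q_log_concave[OF Narayana_weights[OF qnonneg_qvar]])
      (simp_all only: Narayana_triangle.simps add_0 split: if_split, simp)
qed

end
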